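(* $LAvg$ is strongly internal: for every infinite bounded $H\subset\mathbb{R}$ for which $LAvg(H)$ exists, $\varliminf H\le LAvg(H)\le\varlimsup H$.
   Context: For $H\subset\mathbb{R}$, $\delta>0$: $S(H,\delta)=\{y\in\mathbb{R}:\exists x\in H,\ |x-y|<\delta\}$. $\lambda$ is Lebesgue measure; for bounded measurable $K$ with $\lambda(K)>0$, $Avg(K)=\frac{\int_K x\,d\lambda}{\lambda(K)}$. $LAvg(H)=\lim_{\delta\to 0+0}Avg(S(H,\delta))$ if the limit exists. For infinite bounded $H$, $\varliminf H=\inf H'$, $\varlimsup H=\sup H'$, where $H'$ is the set of accumulation points of $H$. *)

theory Defs
  imports "HOL-Analysis.Analysis"
begin

definition nbhd :: "real set \<Rightarrow> real \<Rightarrow> real set" where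
  "nbhd H \<delta> = {y. \<exists>x\<in>H. \<bar>x - y\<bar> < \<delta>}"

text \<open>Meaningful for bounded Lebesgue measurable sets of positive measure.\<close>

definition Avg :: "real set \<Rightarrow> real" where
  "Avg K = (LINT x:K|lebesgue. x) / measure lebesgue K"

definition LAvg_exists :: "real set \<Rightarrow> bool" where
  "LAvg_exists H \<longleftrightarrow> (\<exists>l. ((\<lambda>\<delta>. Avg (nbhd H \<delta>)) \<longlongrightarrow> l) (at_right 0))"

definition LAvg :: "real set \<Rightarrow> real" where
  "LAvg H = Lim (at_right 0) (\<lambda>\<delta>. Avg (nbhd H \<delta>))"

text \<open>
  The smallest and the largest accumulation point of an infinite bounded set; not to be
  confused with the filter-based \<^const>\<open>Liminf\<close> and \<^const>\<open>Limsup\<close>.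
\<close>

definition acc_liminf :: "real set \<Rightarrow> real" where
  "acc_liminf H = Inf {x. x islimpt H}"

definition acc_limsup :: "real set \<Rightarrow> real" where
  "acc_limsup H = Sup {x. x islimpt H}"

text \<open>A mean is a partial function on sets of reals, given as a domain and a total function.\<close>

definition strongly_internal :: "real set set \<Rightarrow> (real set \<Rightarrow> real) \<Rightarrow> bool" where
  "strongly_internal D M \<longleftrightarrow> (\<forall>H\<in>D. acc_liminf H \<le> M H \<and> M H \<le> acc_limsup H)"

end

theory Submission
  imports Defs
begin

text \<open>
  If only finitely many points of \<open>H\<close> lie below \<open>c'\<close>, then for small \<open>\<delta>\<close> the part of \<open>S(H,\<delta>)\<close> below
  some \<open>c < c'\<close> has measure \<open>O(\<delta>)\<close>. But \<open>\<lambda>(S(H,\<delta>)) / \<delta>\<close> tends to infinity, because \<open>H\<close> contains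
  arbitrarily many points and their \<open>\<delta>\<close>-balls are eventually disjoint. So that part does not
  influence the limit of the averages, which is therefore at least \<open>c\<close>.
\<close>

lemma nbhd_eq_UN_ball: "nbhd H \<delta> = (\<Union>x\<in>H. ball x \<delta>)"
  by (auto simp: nbhd_def dist_real_def)

lemma open_nbhd [simp]: "open (nbhd H \<delta>)"
  by (auto simp: nbhd_eq_UN_ball)

lemma bounded_nbhd:
  assumes "bounded H"
  shows "bounded (nbhd H \<delta>)"
proof -
  obtain B where B: "\<And>x. x \<in> H \<Longrightarrow> \<bar>x\<bar> \<le> B"
    using assms by (auto simp: bounded_iff)
  have "\<bar>y\<bar> \<le> B + \<delta>" if "y \<in> nbhd H \<delta>" for y
    using that B by (force simp: nbhd_def)
  thus ?thesis by (auto simp: bounded_iff)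
qed

lemma lmeasurable_nbhd: "bounded H \<Longrightarrow> nbhd H \<delta> \<in> lmeasurable"
  by (intro lmeasurable_open bounded_nbhd open_nbhd)

lemma measure_nbhd_finite_le:
  assumes "finite F" "\<delta> > 0"
  shows "measure lebesgue (nbhd F \<delta>) \<le> 2 * \<delta> * card F"
proof -
  have "measure lebesgue (nbhd F \<delta>) \<le> (\<Sum>x\<in>F. measure lebesgue (ball x \<delta>))"
    unfolding nbhd_eq_UN_ball using assms by (intro measure_UNION_le) auto
  also have "\<dots> = 2 * \<delta> * card F"
    using assms by (simp add: ball_eq_greaterThanLessThan)
  finally show ?thesis .
qed

text \<open>Once \<open>2 * \<delta>\<close> is below the least distance between \<open>N\<close>
  chosen points of \<open>H\<close>, their balls are disjoint, each of measure
  \<open>2 * \<delta>\<close>, and all lie in \<open>nbhd H \<delta>\<close>.\<close>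

lemma eventually_measure_nbhd_ge:
  assumes "infinite H" "bounded H"
  shows "\<forall>\<^sub>F \<delta> in at_right 0. 2 * \<delta> * real N \<le> measure lebesgue (nbhd H \<delta>)"
proof -
  obtain G where G: "G \<subseteq> H" "finite G" "card G = N"
    using infinite_arbitrarily_large[OF assms(1)] by blast
  have "\<forall>\<^sub>F \<delta> in at_right (0::real). \<forall>x\<in>G. \<forall>y\<in>G. x \<noteq> y \<longrightarrow> 2 * \<delta> < \<bar>x - y\<bar>"
  proof (intro eventually_ball_finite \<open>finite G\<close> ballI)
    fix x y :: real
    show "\<forall>\<^sub>F \<delta> in at_right 0. x \<noteq> y \<longrightarrow> 2 * \<delta> < \<bar>x - y\<bar>"
    proof (cases "x = y")
      case False
      hence "\<bar>x - y\<bar> / 2 > 0" by simp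
      from eventually_at_right_less[of 0] eventually_at_right_real[OF this]
      show ?thesis by eventually_elim auto
    qed auto
  qed
  thus ?thesis
    using eventually_at_right_less[of 0]
  proof eventually_elim
    case (elim \<delta>)
    have "disjoint_family_on (\<lambda>x. ball x \<delta>) G"
      unfolding disjoint_family_on_def using elim
      by (force simp: dist_real_def)
    hence "measure lebesgue (nbhd G \<delta>) = (\<Sum>x\<in>G. measure lebesgue (ball x \<delta>))"
      unfolding nbhd_eq_UN_ball using G elim
      by (intro measure_finite_Union) (auto simp: ball_eq_greaterThanLessThan)
    also have "\<dots> = 2 * \<delta> * N"
      using G elim by (simp add: ball_eq_greaterThanLessThan)
    finally have "2 * \<delta> * N = measure lebesgue (nbhd G \<delta>)" by simp
    also have "\<dots> \<le> measure lebesgue (nbhd H \<delta>)"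
      using G assms lmeasurable_nbhd[of _ \<delta>]
      by (intro measure_mono_fmeasurable) (auto simp: nbhd_eq_UN_ball)
    finally show ?case .
  qed
qed

text \<open>The numerator is at most \<open>2 * \<delta> * card F\<close>, the denominator
  eventually at least \<open>2 * \<delta> * N\<close> for any fixed \<open>N\<close>; so the ratio
  is eventually at most \<open>card F / N\<close>, with \<open>N\<close> as large as
  desired.\<close>

lemma measure_nbhd_finite_ratio_tendsto_0:
  assumes "infinite H" "bounded H" "finite F"
  shows "((\<lambda>\<delta>. measure lebesgue (nbhd F \<delta>) / measure lebesgue (nbhd H \<delta>)) \<longlongrightarrow> 0) (at_right 0)"
proof (rule tendstoI)
  fix e :: real assume "e > 0"
  obtain N :: nat where N: "card F / e < N"
    using reals_Archimedean2 by blast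
  hence "N > 0" using \<open>e > 0\<close> by (cases N) (auto simp: field_simps)
  from eventually_measure_nbhd_ge[OF assms(1,2), of N] eventually_at_right_less[of "0::real"]
  show "\<forall>\<^sub>F \<delta> in at_right 0.
      dist (measure lebesgue (nbhd F \<delta>) / measure lebesgue (nbhd H \<delta>)) 0 < e"
  proof eventually_elim
    case (elim \<delta>)
    have pos: "measure lebesgue (nbhd H \<delta>) > 0"
      using elim \<open>N > 0\<close> by (intro less_le_trans[OF _ elim(1)]) auto
    have "measure lebesgue (nbhd F \<delta>) \<le> 2 * \<delta> * card F"
      using measure_nbhd_finite_le assms(3) elim(2) by blast
    also have "\<dots> < e * (2 * \<delta> * N)"
      using N \<open>e > 0\<close> elim(2) by (simp add: field_simps)
    also have "\<dots> \<le> e * measure lebesgue (nbhd H \<delta>)"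
      using elim(1) \<open>e > 0\<close> by (intro mult_left_mono) auto
    finally show ?case using pos by (simp add: field_simps)
  qed
qed

lemma set_integrable_continuous_bounded:
  fixes f :: "real \<Rightarrow> real"
  assumes "continuous_on UNIV f" "bounded S" "S \<in> sets lebesgue"
  shows "set_integrable lebesgue S f"
proof -
  obtain a b where ab: "S \<subseteq> cbox a b"
    using bounded_subset_cbox_symmetric[OF assms(2)] by blast
  have "integrable (lebesgue_on (cbox a b)) f"
    using assms(1) by (intro continuous_imp_integrable) (auto intro: continuous_on_subset)
  hence "set_integrable lebesgue (cbox a b) f"
    by (simp add: set_integrable_def integrable_restrict_space)
  thus ?thesis using set_integrable_subset assms(3) ab by blast
qed

text \<open>The sign \<open>s\<close> treats the lower and the upper bound at once.\<close>

lemma Avg_nbhd_ge: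
  assumes "bounded H" "\<bar>s\<bar> = 1" "0 < \<delta>"
    and pos: "measure lebesgue (nbhd H \<delta>) > 0"
    and far: "\<And>x. x \<in> H \<Longrightarrow> x \<notin> F \<Longrightarrow> c + \<delta> \<le> s * x"
    and M: "\<And>x. x \<in> nbhd H \<delta> \<Longrightarrow> c - M \<le> s * x" and "0 \<le> M" and "bounded F"
  shows "c - M * (measure lebesgue (nbhd F \<delta>) / measure lebesgue (nbhd H \<delta>))
           \<le> s * Avg (nbhd H \<delta>)"
proof -
  define S T where "S = nbhd H \<delta>" and "T = nbhd F \<delta>"
  have S: "S \<in> lmeasurable" "bounded S" and T: "T \<in> lmeasurable"
    using assms lmeasurable_nbhd bounded_nbhd by (auto simp: S_def T_def)
  have int_id: "set_integrable lebesgue S (\<lambda>x. s * x)"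
    and int_c: "set_integrable lebesgue S (\<lambda>x. c)"
    using S by (auto intro!: set_integrable_continuous_bounded continuous_intros)
  have "integrable lebesgue (\<lambda>x. indicat_real (S \<inter> T) x)"
    using fmeasurable.Int[OF S(1) T] fmeasurableD2
    by (intro integrable_real_indicator) (auto simp: fmeasurableD less_top simp del: emeasure_completion)
  hence int_T: "set_integrable lebesgue S (\<lambda>x. M * indicator T x)"
    by (simp add: set_integrable_def indicator_inter_arith[abs_def] mult.left_commute)
  \<comment> \<open>A pointwise minorant to integrate: near \<open>F\<close> only the crude bound
    \<open>c - M\<close> is available; any other point of \<open>S\<close> is within
    \<open>\<delta>\<close> of some \<open>y\<close> in \<open>H\<close> outside \<open>F\<close>,
    and the margin in \<open>far\<close> absorbs this distance.\<close>
  have "c - M * indicator T x \<le> s * x" if "x \<in> S" for x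
  proof (cases "x \<in> T")
    case True
    thus ?thesis using M that by (simp add: S_def)
  next
    case False
    from that obtain y where y: "y \<in> H" "\<bar>y - x\<bar> < \<delta>" by (auto simp: S_def nbhd_def)
    hence "c + \<delta> \<le> s * y" using far False by (auto simp: T_def nbhd_def)
    moreover have "\<bar>s * y - s * x\<bar> < \<delta>"
      using y \<open>\<bar>s\<bar> = 1\<close> by (simp add: abs_mult flip: right_diff_distrib)
    ultimately show ?thesis using False by simp
  qed
  hence "(LINT x:S|lebesgue. c - M * indicator T x) \<le> (LINT x:S|lebesgue. s * x)"
    using int_id int_c int_T by (intro set_integral_mono set_integral_diff) auto
  also have "(LINT x:S|lebesgue. c - M * indicator T x) =
      c * measure lebesgue S - M * measure lebesgue (S \<inter> T)"
  proof -
    have "(LINT x:S|lebesgue. M * indicator T x) = M * measure lebesgue (S \<inter> T)"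
      using S T by (simp add: set_lebesgue_integral_def mult.left_commute
          flip: indicator_inter_arith)
    moreover have "(LINT x:S|lebesgue. c) = c * measure lebesgue S"
      using S by (simp add: set_lebesgue_integral_def)
    ultimately show ?thesis using int_c int_T by simp
  qed
  also have "(LINT x:S|lebesgue. s * x) = s * Avg S * measure lebesgue S"
    using pos by (simp add: Avg_def S_def)
  finally have "c * measure lebesgue S - M * measure lebesgue (S \<inter> T) \<le>
      s * Avg S * measure lebesgue S" .
  \<comment> \<open>Enlarging \<open>S \<inter> T\<close> to \<open>T\<close> weakens the lower
    bound because \<open>M\<close> is nonnegative, and leaves the ratio whose limit is
    known.\<close>
  moreover have "M * measure lebesgue (S \<inter> T) \<le> M * measure lebesgue T"
    using \<open>0 \<le> M\<close> S T by (intro mult_left_mono measure_mono_fmeasurable) auto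
  ultimately show ?thesis using pos by (simp add: S_def T_def field_simps)
qed

text \<open>The finitely many exceptional points contribute an error that vanishes in the limit.
  With \<open>s = 1\<close> this bounds \<open>l\<close> from below, with \<open>s = -1\<close> from
  above.\<close>

lemma Avg_nbhd_limit_ge:
  assumes "infinite H" "bounded H" "\<bar>s\<bar> = 1"
    and fin: "finite {x\<in>H. s * x < c'}"
    and lim: "((\<lambda>\<delta>. Avg (nbhd H \<delta>)) \<longlongrightarrow> l) (at_right 0)"
  shows "c' \<le> s * l"
proof (rule dense_le)
  \<comment> \<open>Balls around points with \<open>s * x \<ge> c'\<close> reach below
    \<open>c'\<close>, but for small \<open>\<delta>\<close> not below \<open>c\<close>.\<close>
  fix c assume "c < c'"
  define F where "F = {x\<in>H. s * x < c'}"
  obtain B where B: "\<And>x. x \<in> nbhd H 1 \<Longrightarrow> \<bar>x\<bar> \<le> B"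
    using bounded_nbhd[OF assms(2), of 1] by (auto simp: bounded_iff)
  \<comment> \<open>Chosen so that \<open>c - M \<le> - \<bar>B\<bar>\<close>. Radius 1 makes
    \<open>M\<close> independent of \<open>\<delta>\<close>.\<close>
  define M where "M = \<bar>c\<bar> + \<bar>B\<bar>"
  have M: "c - M \<le> s * x" if "x \<in> nbhd H 1" for x
  proof -
    have "\<bar>s * x\<bar> \<le> B" using B[OF that] assms(3) by (simp add: abs_mult)
    thus ?thesis unfolding M_def by linarith
  qed
  have "((\<lambda>\<delta>. c - M * (measure lebesgue (nbhd F \<delta>) / measure lebesgue (nbhd H \<delta>)))
      \<longlongrightarrow> c - M * 0) (at_right 0)"
    using assms fin by (intro tendsto_intros measure_nbhd_finite_ratio_tendsto_0) (auto simp: F_def)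
  moreover have "((\<lambda>\<delta>. s * Avg (nbhd H \<delta>)) \<longlongrightarrow> s * l) (at_right 0)"
    using lim by (intro tendsto_intros)
  moreover have "\<forall>\<^sub>F \<delta> in at_right 0.
      c - M * (measure lebesgue (nbhd F \<delta>) / measure lebesgue (nbhd H \<delta>)) \<le> s * Avg (nbhd H \<delta>)"
  proof -
    \<comment> \<open>\<open>\<delta> < 1\<close> makes the bound by \<open>M\<close> applicable,
      \<open>\<delta> < c' - c\<close> gives the margin \<open>c + \<delta> \<le> c'\<close>, and
      the measure estimate with one point gives positive measure.\<close>
    have "0 < min 1 (c' - c)" using \<open>c < c'\<close> by simp
    from eventually_at_right_real[OF this] eventually_measure_nbhd_ge[OF assms(1,2), of 1]
    show ?thesis
    proof eventually_elim
      case (elim \<delta>)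
      have "nbhd H \<delta> \<subseteq> nbhd H 1" using elim by (force simp: nbhd_def)
      thus ?case
        using elim assms M fin
        by (intro Avg_nbhd_ge) (auto simp: F_def M_def not_less finite_imp_bounded)
    qed
  qed
  ultimately show "c \<le> s * l"
    using tendsto_le[OF trivial_limit_at_right_real] by force
qed

lemma bounded_islimpt:
  fixes H :: "'a::metric_space set"
  shows "bounded H \<Longrightarrow> bounded {x. x islimpt H}"
  by (rule bounded_subset[OF bounded_closure]) (auto simp: closure_def)

text \<open>Otherwise Bolzano-Weierstrass yields an accumulation point of \<open>H\<close> that is
  at most \<open>c\<close>, hence below the infimum of all of them.\<close>

lemma finite_below_acc_liminf:
  assumes "bounded H" "c < acc_liminf H"
  shows "finite {x\<in>H. x < c}"
proof (rule ccontr)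
  assume "infinite {x\<in>H. x < c}"
  moreover have "bounded {x\<in>H. x < c}"
    using assms(1) by (rule bounded_subset) auto
  ultimately obtain x where x: "x islimpt {x\<in>H. x < c}"
    using bounded_infinite_imp_islimpt by blast
  hence "x islimpt {..c}" "x islimpt H"
    by (auto elim!: islimpt_subset)
  moreover have "x \<le> c"
    using \<open>x islimpt {..c}\<close> closed_limpt[of "{..c}"] by auto
  moreover have "acc_liminf H \<le> x"
    unfolding acc_liminf_def using \<open>x islimpt H\<close> bounded_islimpt[OF assms(1)]
    by (intro cInf_lower bounded_imp_bdd_below) auto
  ultimately show False using assms(2) by simp
qed

lemma finite_above_acc_limsup:
  assumes "bounded H" "acc_limsup H < c"
  shows "finite {x\<in>H. c < x}"
proof (rule ccontr)
  assume "infinite {x\<in>H. c < x}"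
  moreover have "bounded {x\<in>H. c < x}"
    using assms(1) by (rule bounded_subset) auto
  ultimately obtain x where x: "x islimpt {x\<in>H. c < x}"
    using bounded_infinite_imp_islimpt by blast
  hence "x islimpt {c..}" "x islimpt H"
    by (auto elim!: islimpt_subset)
  moreover have "c \<le> x"
    using \<open>x islimpt {c..}\<close> closed_limpt[of "{c..}"] by auto
  moreover have "x \<le> acc_limsup H"
    unfolding acc_limsup_def using \<open>x islimpt H\<close> bounded_islimpt[OF assms(1)]
    by (intro cSup_upper bounded_imp_bdd_above) auto
  ultimately show False using assms(2) by simp
qed

theorem proposition5p5:
  shows "strongly_internal {H. infinite H \<and> bounded H \<and> LAvg_exists H} LAvg"
  unfolding strongly_internal_def
proof (intro ballI conjI)
  fix H assume "H \<in> {H. infinite H \<and> bounded H \<and> LAvg_exists H}"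
  hence H: "infinite H" "bounded H" and "LAvg_exists H" by auto
  then obtain l where l: "((\<lambda>\<delta>. Avg (nbhd H \<delta>)) \<longlongrightarrow> l) (at_right 0)"
    by (auto simp: LAvg_exists_def)
  hence "LAvg H = l"
    unfolding LAvg_def by (intro tendsto_Lim) auto
  show "acc_liminf H \<le> LAvg H"
  proof (rule dense_le)
    \<comment> \<open>Infinitely many points of \<open>H\<close> may lie below
      \<open>acc_liminf H\<close> itself, as in a sequence increasing to its limit; below a strictly
      smaller \<open>c\<close> there are only finitely many.\<close>
    fix c assume "c < acc_liminf H"
    with H l show "c \<le> LAvg H"
      using Avg_nbhd_limit_ge[of H 1 c l] finite_below_acc_liminf \<open>LAvg H = l\<close> by simp
  qed
  show "LAvg H \<le> acc_limsup H"
  proof (rule dense_ge)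
    fix c assume "acc_limsup H < c"
    \<comment> \<open>Reflection at 0: \<open>- x < - c\<close> selects the finitely many points
      above \<open>c\<close>, and the bound \<open>- c \<le> - l\<close> is the claim.\<close>
    with H l show "LAvg H \<le> c"
      using Avg_nbhd_limit_ge[of H "-1" "-c" l] finite_above_acc_limsup \<open>LAvg H = l\<close> by simp
  qed
qed

end
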